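(* Let $\boldsymbol\rho_h=\boldsymbol\rho_h(\cdot,t)\in\boldsymbol V_h$ and $\boldsymbol u_h=\boldsymbol u_h(\cdot,t)\in\boldsymbol V_h$ be obtained from the one-dimensional semi-discrete scheme (S1)–(S2) described in the context, with either the central and Lax–Friedrichs fluxes or the alternating fluxes, and let $$E_h=\widetilde{\int_\Omega} e(\boldsymbol\rho_h)\,dx$$ be the associated discrete entropy. Then: (1) for the central and Lax–Friedrichs fluxes, $$\frac{d}{dt}E_h=-\widetilde{\int_\Omega}\boldsymbol u_h\cdot F_h\boldsymbol u_h\,dx-\frac12\sum_{i=1}^N\alpha_{i+\frac12}[\boldsymbol\xi_h]_{i+\frac12}\cdot[\boldsymbol\rho_h]_{i+\frac12}\le 0;$$ (2) for the alternating fluxes, $$\frac{d}{dt}E_h=-\widetilde{\int_\Omega}\boldsymbol u_h\cdot F_h\boldsymbol u_h\,dx.$$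
   Context: **Continuous problem.** On a bounded interval $\Omega\subset\mathbb R$ consider $\partial_t\boldsymbol\rho=\partial_x(F(\boldsymbol\rho)\partial_x\boldsymbol\xi(\boldsymbol\rho))$ for $\boldsymbol\rho=(\rho_1,\dots,\rho_m)^T$. Here $e=e(\boldsymbol\rho)$ is a scalar-valued twice differentiable convex function, $\boldsymbol\xi=(\partial_{\rho_1}e,\dots,\partial_{\rho_m}e)^T$, and $F(\boldsymbol\rho)$ is an $m\times m$ matrix, possibly non-symmetric, that is positive semidefinite in the sense $\boldsymbol z\cdot F\boldsymbol z\ge0$ for all $\boldsymbol z\in\mathbb R^m$. The functions $e,\boldsymbol\xi,F$ are defined on a convex set of states in which $\boldsymbol\rho_h$ takes its values. The periodic boundary condition (or compact support, treated in the same way) is assumed: the endpoints $x_{\frac12}$ and $x_{N+\frac12}$ are identified, so all interface quantities at $\frac12$ and $N+\frac12$ coincide. **Mesh and space.** $\Omega$ is partitioned into cells $I_i=(x_{i-\frac12},x_{i+\frac12})$, $i=1,\dots,N$, with $h_i=x_{i+\frac12}-x_{i-\frac12}$, $h=\max_i h_i$ and $h_i\ge c_{mesh}h$ for a fixed constant $c_{mesh}>0$. For $k\ge1$, $V_h=\{v_h: v_h|_{I_i}\in P^k(I_i)\ \forall i\}$ ($P^k$: polynomials of degree at most $k$; no continuity across interfaces), and $\boldsymbol V_h=\prod_{l=1}^m V_h$. At an interface, $\boldsymbol v^-$ and $\boldsymbol v^+$ denote left and right limits, $\{\boldsymbol v\}=\frac12(\boldsymbol v^++\boldsymbol v^-)$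 and $[\boldsymbol v]=\boldsymbol v^+-\boldsymbol v^-$. **Quadrature.** $\{x_i^r\}_{r=1}^{k+1}$ are the $k+1$ Gauss–Lobatto points on $I_i$ (including both endpoints, where one-sided limits from inside $I_i$ are used), and $w_r$ are the corresponding weights on $[-1,1]$. Set $$\widetilde{\int_{I_i}}\boldsymbol\varphi\cdot\boldsymbol\psi\,dx=\frac{h_i}{2}\sum_{r=1}^{k+1}w_r\,\boldsymbol\varphi(x_i^r)\cdot\boldsymbol\psi(x_i^r),\qquad \widetilde{\int_{I_i}}\boldsymbol\varphi\cdot\partial_x\boldsymbol\psi\,dx=\frac{h_i}{2}\sum_{r=1}^{k+1}w_r\,\boldsymbol\varphi(x_i^r)\cdot\partial_x(\mathcal I\boldsymbol\psi)(x_i^r),$$ where $\mathcal I$ is componentwise degree-$k$ polynomial interpolation at the Gauss–Lobatto points of $I_i$; for scalar functions $\widetilde{\int_{I_i}}$ is the same quadrature sum, and $\widetilde{\int_\Omega}\cdot\,dx=\sum_{i=1}^N\widetilde{\int_{I_i}}\cdot\,dx$. **Semi-discrete scheme.** With $F_h=F(\boldsymbol\rho_h)$ and $\boldsymbol\xi_h=\boldsymbol\xi(\boldsymbol\rho_h)$, find $\boldsymbol\rho_h,\boldsymbol u_h\in\boldsymbol V_h$ ($\boldsymbol\rho_h$ differentiable in $t$) such that for all $\boldsymbol\varphi_h,\boldsymbol\psi_h\in\boldsymbol V_h$ and all $i$: $$\text{(S1)}\quad \widetilde{\int_{I_i}}\partial_t\boldsymbol\rho_h\cdot\boldsymbol\varphi_h\,dx=-\widetilde{\int_{I_i}}F_h\boldsymbol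 u_h\cdot\partial_x\boldsymbol\varphi_h\,dx+(\widehat{F\boldsymbol u}\cdot\boldsymbol\varphi_h^-)_{i+\frac12}-(\widehat{F\boldsymbol u}\cdot\boldsymbol\varphi_h^+)_{i-\frac12},$$ $$\text{(S2)}\quad \widetilde{\int_{I_i}}\boldsymbol u_h\cdot\boldsymbol\psi_h\,dx=-\widetilde{\int_{I_i}}\boldsymbol\xi_h\cdot\partial_x\boldsymbol\psi_h\,dx+(\widehat{\boldsymbol\xi}\cdot\boldsymbol\psi_h^-)_{i+\frac12}-(\widehat{\boldsymbol\xi}\cdot\boldsymbol\psi_h^+)_{i-\frac12}.$$ **Numerical fluxes (at each interface).** - Central and Lax–Friedrichs fluxes: $\widehat{\boldsymbol\xi}=\{\boldsymbol\xi_h\}$, $\widehat{F\boldsymbol u}=\{F_h\boldsymbol u_h\}+\frac{\alpha}{2}[\boldsymbol\rho_h]$, with $\alpha=\max(|\boldsymbol v_h^+|_\infty,|\boldsymbol v_h^-|_\infty)$, $\boldsymbol v_h=\mathrm{diag}(\boldsymbol\rho_h)^{-1}F_h\boldsymbol u_h$, and $|\cdot|_\infty$ the $\ell^\infty$ norm on $\mathbb R^m$. For this choice $\mathrm{diag}(\boldsymbol\rho)^{-1}F(\boldsymbol\rho)$ is assumed bounded, so that $\boldsymbol v_h$ is well-defined. - Alternating fluxes: either $\widehat{\boldsymbol\xi}=\boldsymbol\xi_h^-$ and $\widehat{F\boldsymbol u}=(F_h\boldsymbol u_h)^+$ at all interfaces, or $\widehat{\boldsymbol\xi}=\boldsymbol\xi_h^+$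 and $\widehat{F\boldsymbol u}=(F_h\boldsymbol u_h)^-$ at all interfaces. *)

theory Defs
  imports "HOL-Analysis.Analysis" "HOL-Computational_Algebra.Polynomial"
begin

section \<open>Gauss--Lobatto quadrature and interpolation\<close>

text \<open>Rodrigues' formula.\<close>

definition legendre :: "nat \<Rightarrow> real poly" where
  "legendre n = smult (1 / (2 ^ n * fact n)) ((pderiv ^^ n) ([:-1, 0, 1:] ^ n))"

text \<open>
  The \<open>k + 1\<close> Gauss--Lobatto points on \<open>[-1, 1]\<close>, for \<open>k \<ge> 1\<close>: both endpoints and the
  \<open>k - 1\<close> zeros of \<open>P\<^sub>k'\<close>.  They are kept as a finite set; sums over \<open>r = 1, \<dots>, k + 1\<close>
  become sums over this set.
\<close>

definition gl_nodes :: "nat \<Rightarrow> real set" where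
  "gl_nodes k = {z. poly ([:-1, 0, 1:] * pderiv (legendre k)) z = 0}"

definition lagrange_basis :: "real set \<Rightarrow> real \<Rightarrow> real poly" where
  "lagrange_basis A z = (\<Prod>y\<in>A - {z}. smult (1 / (z - y)) [:- y, 1:])"

definition gl_weight :: "nat \<Rightarrow> real \<Rightarrow> real" where
  "gl_weight k z = integral {-1..1} (poly (lagrange_basis (gl_nodes k) z))"

definition gl_point :: "real \<Rightarrow> real \<Rightarrow> real \<Rightarrow> real" where
  "gl_point a b z = (a + b) / 2 + (b - a) / 2 * z"

definition gl_quad :: "nat \<Rightarrow> real \<Rightarrow> real \<Rightarrow> (real \<Rightarrow> real) \<Rightarrow> real" where
  "gl_quad k a b g = (b - a) / 2 * (\<Sum>z\<in>gl_nodes k. gl_weight k z * g (gl_point a b z))"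

text \<open>
  The interpolant is a polynomial on the whole line, so its derivative at the endpoints of
  \<open>[a, b]\<close> is the one-sided derivative from inside.
\<close>

definition gl_interp :: "nat \<Rightarrow> real \<Rightarrow> real \<Rightarrow> (real \<Rightarrow> real ^ 'm) \<Rightarrow> real \<Rightarrow> real ^ 'm" where
  "gl_interp k a b \<psi> y =
     (\<Sum>p\<in>gl_point a b ` gl_nodes k.
        poly (lagrange_basis (gl_point a b ` gl_nodes k) p) y *\<^sub>R \<psi> p)"

section \<open>Mesh, discontinuous space, traces\<close>

text \<open>
  The mesh is \<open>x :: nat \<Rightarrow> real\<close>, where \<open>x i\<close> is the interface \<open>x\<^bsub>i+1/2\<^esub>\<close>, \<open>i = 0, \<dots>, N\<close>.
\<close>

definition mesh_width :: "(nat \<Rightarrow> real) \<Rightarrow> nat \<Rightarrow> real" where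
  "mesh_width x i = x i - x (i - 1)"

definition cell :: "(nat \<Rightarrow> real) \<Rightarrow> nat \<Rightarrow> real set" where
  "cell x i = {x (i - 1) <..< x i}"

definition is_mesh :: "real \<Rightarrow> real \<Rightarrow> nat \<Rightarrow> (nat \<Rightarrow> real) \<Rightarrow> real \<Rightarrow> bool" where
  "is_mesh a b N x c \<longleftrightarrow>
     N \<ge> 1 \<and> x 0 = a \<and> x N = b \<and> (\<forall>i\<in>{1..N}. x (i - 1) < x i) \<and>
     c > 0 \<and> (\<forall>i\<in>{1..N}. mesh_width x i \<ge> c * Max (mesh_width x ` {1..N}))"

text \<open>\<open>V\<^sub>h\<close> (vector-valued).  Values at the interfaces and outside the interval are irrelevant.\<close>

definition dg_space :: "nat \<Rightarrow> (nat \<Rightarrow> real) \<Rightarrow> nat \<Rightarrow> (real \<Rightarrow> real ^ 'm) set" where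
  "dg_space N x k =
     {v. \<forall>i\<in>{1..N}. \<forall>l. \<exists>p. degree p \<le> k \<and> (\<forall>y\<in>cell x i. v y $ l = poly p y)}"

text \<open>
  \<open>on_cells x v i\<close> is \<open>v\<close> on the closed cell \<open>i\<close>: its value at interior points, its one-sided
  limit from inside the cell at the two endpoints.  Functions such as \<open>\<xi>(\<rho>\<^sub>h)\<close> are treated as
  cellwise functions \<open>nat \<Rightarrow> real \<Rightarrow> _\<close> of the same kind, obtained by applying \<open>\<xi>\<close> to these
  values of \<open>\<rho>\<^sub>h\<close>.
\<close>

definition on_cells :: "(nat \<Rightarrow> real) \<Rightarrow> (real \<Rightarrow> 'b::t2_space) \<Rightarrow> nat \<Rightarrow> real \<Rightarrow> 'b" where
  "on_cells x v i y = Lim (at y within cell x i) v"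

text \<open>
  Left and right limits at interface \<open>i\<close>, \<open>i = 0, \<dots>, N\<close>.  Periodicity: interfaces \<open>0\<close> and \<open>N\<close>
  are identified, the left limit there comes from cell \<open>N\<close> and the right limit from cell \<open>1\<close>.
\<close>

definition trace_minus :: "nat \<Rightarrow> (nat \<Rightarrow> real) \<Rightarrow> (nat \<Rightarrow> real \<Rightarrow> 'b) \<Rightarrow> nat \<Rightarrow> 'b" where
  "trace_minus N x w i = (if i = 0 then w N (x N) else w i (x i))"

definition trace_plus :: "nat \<Rightarrow> (nat \<Rightarrow> real) \<Rightarrow> (nat \<Rightarrow> real \<Rightarrow> 'b) \<Rightarrow> nat \<Rightarrow> 'b" where
  "trace_plus N x w i = (if i = N then w 1 (x 0) else w (i + 1) (x i))"

definition jump ::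
  "nat \<Rightarrow> (nat \<Rightarrow> real) \<Rightarrow> (nat \<Rightarrow> real \<Rightarrow> 'b::real_vector) \<Rightarrow> nat \<Rightarrow> 'b" where
  "jump N x w i = trace_plus N x w i - trace_minus N x w i"

definition average ::
  "nat \<Rightarrow> (nat \<Rightarrow> real) \<Rightarrow> (nat \<Rightarrow> real \<Rightarrow> 'b::real_vector) \<Rightarrow> nat \<Rightarrow> 'b" where
  "average N x w i = (1 / 2) *\<^sub>R (trace_plus N x w i + trace_minus N x w i)"

definition cell_quad :: "nat \<Rightarrow> (nat \<Rightarrow> real) \<Rightarrow> nat \<Rightarrow> (real \<Rightarrow> real) \<Rightarrow> real" where
  "cell_quad k x i g = gl_quad k (x (i - 1)) (x i) g"

definition domain_quad :: "nat \<Rightarrow> (nat \<Rightarrow> real) \<Rightarrow> nat \<Rightarrow> (nat \<Rightarrow> real \<Rightarrow> real) \<Rightarrow> real" where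
  "domain_quad N x k g = (\<Sum>i=1..N. cell_quad k x i (g i))"

text \<open>\<open>\<partial>\<^sub>x(\<I> \<psi>)\<close> on cell \<open>i\<close>\<close>

definition interp_deriv ::
  "nat \<Rightarrow> (nat \<Rightarrow> real) \<Rightarrow> nat \<Rightarrow> (real \<Rightarrow> real ^ 'm) \<Rightarrow> real \<Rightarrow> real ^ 'm" where
  "interp_deriv k x i \<psi> y = vector_derivative (gl_interp k (x (i - 1)) (x i) \<psi>) (at y)"

section \<open>Entropy and mobility\<close>

text \<open>
  \<open>\<xi>\<close> is the gradient (vector of partial derivatives) of \<open>e\<close>.  The derivative is taken within
  \<open>S\<close>, so that \<open>S\<close> need not be open.
\<close>

definition gradient_on :: "(real ^ 'm) set \<Rightarrow> (real ^ 'm \<Rightarrow> real) \<Rightarrow> (real ^ 'm \<Rightarrow> real ^ 'm) \<Rightarrow> bool" where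
  "gradient_on S e \<xi> \<longleftrightarrow> (\<forall>r\<in>S. (e has_derivative (\<lambda>z. \<xi> r \<bullet> z)) (at r within S))"

definition diag :: "real ^ 'm \<Rightarrow> real ^ 'm ^ 'm" where
  "diag v = (\<chi> i j. if i = j then v $ i else 0)"

text \<open>
  \<open>G\<close> is a bounded version of \<open>diag(\<rho>)\<^sup>-\<^sup>1 F(\<rho>)\<close> on \<open>S\<close>.  Row \<open>l\<close> of \<open>G \<rho>\<close> is determined by
  this equation wherever \<open>\<rho>\<^sub>l \<noteq> 0\<close>; states with \<open>\<rho>\<^sub>l = 0\<close> are admitted provided that
  the quotient has a bounded extension to them.
\<close>

definition bounded_diag_quotient ::
  "(real ^ 'm) set \<Rightarrow> (real ^ 'm \<Rightarrow> real ^ 'm ^ 'm) \<Rightarrow> (real ^ 'm \<Rightarrow> real ^ 'm ^ 'm) \<Rightarrow> bool" where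
  "bounded_diag_quotient S F G \<longleftrightarrow> bounded (G ` S) \<and> (\<forall>r\<in>S. diag r ** G r = F r)"

section \<open>The semi-discrete scheme\<close>

text \<open>\<open>\<xi>\<^sub>h\<close> and \<open>M\<^sub>h u\<^sub>h\<close> (for \<open>M = F\<close> or \<open>M = diag(\<rho>)\<^sup>-\<^sup>1 F\<close>) as cellwise functions\<close>

definition xi_h ::
  "(nat \<Rightarrow> real) \<Rightarrow> (real ^ 'm \<Rightarrow> real ^ 'm) \<Rightarrow> (real \<Rightarrow> real ^ 'm) \<Rightarrow> nat \<Rightarrow> real \<Rightarrow> real ^ 'm" where
  "xi_h x \<xi> \<rho> i y = \<xi> (on_cells x \<rho> i y)"

definition matvec_h ::
  "(nat \<Rightarrow> real) \<Rightarrow> (real ^ 'm \<Rightarrow> real ^ 'm ^ 'm) \<Rightarrow> (real \<Rightarrow> real ^ 'm) \<Rightarrow> (real \<Rightarrow> real ^ 'm)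
    \<Rightarrow> nat \<Rightarrow> real \<Rightarrow> real ^ 'm" where
  "matvec_h x M \<rho> u i y = M (on_cells x \<rho> i y) *v on_cells x u i y"

text \<open>
  (S1)--(S2) at a fixed time; \<open>\<rho>t\<close> stands for \<open>\<partial>\<^sub>t \<rho>\<^sub>h\<close>, and \<open>xihat i\<close>, \<open>Fuhat i\<close> for the
  numerical fluxes at interface \<open>i\<close>.
\<close>

definition S1 ::
  "nat \<Rightarrow> (nat \<Rightarrow> real) \<Rightarrow> nat \<Rightarrow> (real ^ 'm \<Rightarrow> real ^ 'm ^ 'm) \<Rightarrow>
   (real \<Rightarrow> real ^ 'm) \<Rightarrow> (real \<Rightarrow> real ^ 'm) \<Rightarrow> (real \<Rightarrow> real ^ 'm) \<Rightarrow> (nat \<Rightarrow> real ^ 'm) \<Rightarrow> bool" where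
  "S1 N x k F \<rho>t \<rho> u Fuhat \<longleftrightarrow>
     (\<forall>\<phi>\<in>dg_space N x k. \<forall>i\<in>{1..N}.
        cell_quad k x i (\<lambda>y. on_cells x \<rho>t i y \<bullet> on_cells x \<phi> i y) =
        - cell_quad k x i (\<lambda>y. matvec_h x F \<rho> u i y \<bullet> interp_deriv k x i (on_cells x \<phi> i) y)
        + Fuhat i \<bullet> trace_minus N x (on_cells x \<phi>) i
        - Fuhat (i - 1) \<bullet> trace_plus N x (on_cells x \<phi>) (i - 1))"

definition S2 ::
  "nat \<Rightarrow> (nat \<Rightarrow> real) \<Rightarrow> nat \<Rightarrow> (real ^ 'm \<Rightarrow> real ^ 'm) \<Rightarrow>
   (real \<Rightarrow> real ^ 'm) \<Rightarrow> (real \<Rightarrow> real ^ 'm) \<Rightarrow> (nat \<Rightarrow> real ^ 'm) \<Rightarrow> bool" where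
  "S2 N x k \<xi> \<rho> u xihat \<longleftrightarrow>
     (\<forall>\<psi>\<in>dg_space N x k. \<forall>i\<in>{1..N}.
        cell_quad k x i (\<lambda>y. on_cells x u i y \<bullet> on_cells x \<psi> i y) =
        - cell_quad k x i (\<lambda>y. xi_h x \<xi> \<rho> i y \<bullet> interp_deriv k x i (on_cells x \<psi> i) y)
        + xihat i \<bullet> trace_minus N x (on_cells x \<psi>) i
        - xihat (i - 1) \<bullet> trace_plus N x (on_cells x \<psi>) (i - 1))"

text \<open>
  \<open>\<rho>\<close> and \<open>u\<close> (as functions of time, then space) solve the scheme on the time interval \<open>T\<close>
  for given fluxes depending on the current \<open>\<rho>\<^sub>h\<close> and \<open>u\<^sub>h\<close>, with \<open>\<rho>\<^sub>h\<close> taking values in \<open>S\<close>,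
  one-sided limits included.  Time derivatives are one-sided at endpoints belonging to \<open>T\<close>.
\<close>

definition semidiscrete_solution ::
  "real set \<Rightarrow> nat \<Rightarrow> (nat \<Rightarrow> real) \<Rightarrow> nat \<Rightarrow> (real ^ 'm) set \<Rightarrow>
   (real ^ 'm \<Rightarrow> real ^ 'm ^ 'm) \<Rightarrow> (real ^ 'm \<Rightarrow> real ^ 'm) \<Rightarrow>
   ((real \<Rightarrow> real ^ 'm) \<Rightarrow> (real \<Rightarrow> real ^ 'm) \<Rightarrow> nat \<Rightarrow> real ^ 'm) \<Rightarrow>
   ((real \<Rightarrow> real ^ 'm) \<Rightarrow> (real \<Rightarrow> real ^ 'm) \<Rightarrow> nat \<Rightarrow> real ^ 'm) \<Rightarrow>
   (real \<Rightarrow> real \<Rightarrow> real ^ 'm) \<Rightarrow> (real \<Rightarrow> real \<Rightarrow> real ^ 'm) \<Rightarrow> bool" where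
  "semidiscrete_solution T N x k S F \<xi> xihat Fuhat \<rho> u \<longleftrightarrow>
     (\<forall>t\<in>T.
        \<rho> t \<in> dg_space N x k \<and> u t \<in> dg_space N x k \<and>
        (\<forall>i\<in>{1..N}. \<forall>y\<in>{x (i - 1)..x i}. on_cells x (\<rho> t) i y \<in> S) \<and>
        (\<forall>i\<in>{1..N}. \<forall>y\<in>cell x i. (\<lambda>s. \<rho> s y) differentiable (at t within T)) \<and>
        S1 N x k F (\<lambda>y. vector_derivative (\<lambda>s. \<rho> s y) (at t within T)) (\<rho> t) (u t)
          (Fuhat (\<rho> t) (u t)) \<and>
        S2 N x k \<xi> (\<rho> t) (u t) (xihat (\<rho> t) (u t)))"

section \<open>Numerical fluxes\<close>

definition lf_alpha ::
  "nat \<Rightarrow> (nat \<Rightarrow> real) \<Rightarrow> (real ^ 'm \<Rightarrow> real ^ 'm ^ 'm) \<Rightarrow>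
   (real \<Rightarrow> real ^ 'm) \<Rightarrow> (real \<Rightarrow> real ^ 'm) \<Rightarrow> nat \<Rightarrow> real" where
  "lf_alpha N x G \<rho> u i =
     max (infnorm (trace_plus N x (matvec_h x G \<rho> u) i))
         (infnorm (trace_minus N x (matvec_h x G \<rho> u) i))"

definition xihat_central where
  "xihat_central N x \<xi> = (\<lambda>\<rho> u. average N x (xi_h x \<xi> \<rho>))"

definition Fuhat_lf where
  "Fuhat_lf N x F G =
     (\<lambda>\<rho> u i. average N x (matvec_h x F \<rho> u) i
              + (lf_alpha N x G \<rho> u i / 2) *\<^sub>R jump N x (on_cells x \<rho>) i)"

definition xihat_minus where
  "xihat_minus N x \<xi> = (\<lambda>\<rho> u. trace_minus N x (xi_h x \<xi> \<rho>))"

definition xihat_plus where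
  "xihat_plus N x \<xi> = (\<lambda>\<rho> u. trace_plus N x (xi_h x \<xi> \<rho>))"

definition Fuhat_minus where
  "Fuhat_minus N x F = (\<lambda>\<rho> u. trace_minus N x (matvec_h x F \<rho> u))"

definition Fuhat_plus where
  "Fuhat_plus N x F = (\<lambda>\<rho> u. trace_plus N x (matvec_h x F \<rho> u))"

section \<open>Discrete entropy and dissipation\<close>

definition discrete_entropy ::
  "nat \<Rightarrow> (nat \<Rightarrow> real) \<Rightarrow> nat \<Rightarrow> (real ^ 'm \<Rightarrow> real) \<Rightarrow> (real \<Rightarrow> real ^ 'm) \<Rightarrow> real" where
  "discrete_entropy N x k e \<rho> = domain_quad N x k (\<lambda>i y. e (on_cells x \<rho> i y))"

definition dissipation ::
  "nat \<Rightarrow> (nat \<Rightarrow> real) \<Rightarrow> nat \<Rightarrow> (real ^ 'm \<Rightarrow> real ^ 'm ^ 'm) \<Rightarrow>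
   (real \<Rightarrow> real ^ 'm) \<Rightarrow> (real \<Rightarrow> real ^ 'm) \<Rightarrow> real" where
  "dissipation N x k F \<rho> u =
     domain_quad N x k (\<lambda>i y. on_cells x u i y \<bullet> matvec_h x F \<rho> u i y)"

end

theory Submission
  imports Defs
begin

text \<open>
  Test (S1) with the interpolant of \<open>\<xi>\<^sub>h\<close> and (S2) with the interpolant of \<open>F\<^sub>h u\<^sub>h\<close> and add.  The left
  sides give the time derivative of the discrete entropy plus the dissipation.  The two volume
  terms on the right combine into the quadrature of the derivative of a polynomial of degree
  \<open>2k\<close>; Gauss--Lobatto quadrature is exact in degree \<open>2k - 1\<close>, so they reduce to boundary terms.
  Collected at each interface, these cancel for alternating fluxes, and for the central and
  Lax--Friedrichs fluxes leave the penalty \<open>- \<alpha> / 2 [\<xi>] \<bullet> [\<rho>]\<close>, which has a sign because the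
  gradient of a convex function is monotone.  Exactness and positivity of the weights follow from
  the orthogonality of the Legendre polynomial \<open>P\<^sub>k\<close> to polynomials of lower degree.
\<close>

section \<open>Exactness and positivity of Gauss--Lobatto quadrature\<close>

lemma integral_poly_pderiv:
  assumes "a \<le> b"
  shows "integral {a..b} (poly (pderiv p)) = poly p b - poly p (a::real)"
proof (rule integral_unique, rule fundamental_theorem_of_calculus[OF assms])
  show "(poly p has_vector_derivative poly (pderiv p) y) (at y within {a..b})" for y
    using poly_DERIV[of p y]
    by (meson has_field_derivative_at_within has_real_derivative_iff_has_vector_derivative)
qed

lemma poly_integrable: "poly (p::real poly) integrable_on {a..b}"
  by (intro integrable_continuous_real continuous_intros)

lemma integral_poly_add:
  "integral {a..b} (poly (p + q)) = integral {a..b} (poly p) + integral {a..b} (poly (q::real poly))"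
  using Henstock_Kurzweil_Integration.integral_add[OF poly_integrable[of p] poly_integrable[of q]]
  by (simp add: poly_add[abs_def])

lemma integral_poly_sum_smult:
  assumes "finite A"
  shows "integral {a..b} (poly (\<Sum>z\<in>A. smult (c z) (p z))) =
         (\<Sum>z\<in>A. c z * integral {a..b} (poly (p z :: real poly)))"
proof -
  have "poly (\<Sum>z\<in>A. smult (c z) (p z)) = (\<lambda>y. \<Sum>z\<in>A. c z * poly (p z) y)"
    by (simp add: fun_eq_iff poly_sum)
  moreover have "(\<lambda>y. c z * poly (p z) y) integrable_on {a..b}" for z
    by (intro integrable_continuous_real continuous_intros)
  ultimately show ?thesis
    using assms by (simp add: Henstock_Kurzweil_Integration.integral_sum)
qed

lemma integral_poly_by_parts:
  assumes "a \<le> b" "poly p a * poly q a = 0" "poly p b * poly q b = (0::real)"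
  shows "integral {a..b} (poly (pderiv p * q)) = - integral {a..b} (poly (p * pderiv q))"
proof -
  have "integral {a..b} (poly (pderiv p * q)) + integral {a..b} (poly (p * pderiv q)) =
        integral {a..b} (poly (pderiv (p * q)))"
    by (simp add: integral_poly_add[symmetric] pderiv_mult algebra_simps)
  also have "\<dots> = 0"
    using assms by (simp only: integral_poly_pderiv poly_mult diff_self)
  finally show ?thesis
    by linarith
qed

text \<open>A continuous nonnegative function with zero integral vanishes on the whole interval,
  which would give a nonzero polynomial infinitely many roots.\<close>

lemma integral_poly_pos:
  assumes "a < b" "p \<noteq> 0" "\<And>y. y \<in> {a..b} \<Longrightarrow> poly p y \<ge> (0::real)"
  shows "integral {a..b} (poly p) > 0"
proof -
  have nonneg: "integral {a..b} (poly p) \<ge> 0"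
    using assms by (intro Henstock_Kurzweil_Integration.integral_nonneg poly_integrable)
  have "integral {a..b} (poly p) \<noteq> 0"
  proof
    assume "integral {a..b} (poly p) = 0"
    then have "(poly p has_integral 0) (cbox a b)"
      by (metis box_real(2) integrable_integral poly_integrable)
    then have "poly p y = 0" if "y \<in> {a..b}" for y
      using that assms
      by (intro has_integral_0_cbox_imp_0[of a b "poly p"]) (auto intro!: continuous_intros)
    then have "{a..b} \<subseteq> {y. poly p y = 0}"
      by auto
    with poly_roots_finite[OF \<open>p \<noteq> 0\<close>] have "finite {a..b}"
      using finite_subset by blast
    with \<open>a < b\<close> show False
      by (simp add: infinite_Icc)
  qed
  with nonneg show ?thesis by simp
qed

section \<open>Zeros and orthogonality of the Legendre polynomials\<close>

text \<open>Induction on the largest element: Rolle's theorem between the old maximum and the new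
  one yields one more zero of the derivative. The clause that each zero lies strictly between
  elements of \<open>A\<close> shows that this zero is new, and later confines zeros to the open
  interval.\<close>

lemma Rolle_roots:
  fixes p :: "real poly"
  assumes "finite A" "A \<noteq> {}" "\<And>y. y \<in> A \<Longrightarrow> poly p y = 0"
  shows "\<exists>B. finite B \<and> card A = Suc (card B) \<and>
           (\<forall>y\<in>B. poly (pderiv p) y = 0 \<and> (\<exists>a\<in>A. a < y) \<and> (\<exists>a\<in>A. y < a))"
  using assms
proof (induction A rule: finite_linorder_max_induct)
  case empty
  then show ?case by simp
next
  case (insert b A)
  show ?case
  proof (cases "A = {}")
    case True
    then show ?thesis by (intro exI[of _ "{}"]) auto
  next
    case False
    with insert obtain B where B: "finite B" "card A = Suc (card B)"
      "\<And>y. y \<in> B \<Longrightarrow> poly (pderiv p) y = 0 \<and> (\<exists>a\<in>A. a < y) \<and> (\<exists>a\<in>A. y < a)"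
      by (metis insertCI)
    have M: "Max A \<in> A" using False insert by simp
    then have "Max A < b" using insert by auto
    from poly_MVT[OF this, of p] obtain c where c: "Max A < c" "c < b" "poly (pderiv p) c = 0"
      using insert.prems M \<open>Max A < b\<close> by auto
    have "c \<notin> B"
    proof
      assume "c \<in> B"
      then obtain a where a: "a \<in> A" "c < a" using B by blast
      with Max_ge[OF insert.hyps(1) a(1)] c(1) show False by (meson less_le_not_le order.strict_trans2 order.strict_trans)
    qed
    moreover have "b \<notin> A" using insert by auto
    ultimately show ?thesis
      using B c M insert by (intro exI[of _ "insert c B"]) auto
  qed
qed

text \<open>Each differentiation lowers the multiplicity of the factor \<open>q\<close> by at most
  one. With \<open>q = [:-1, 0, 1:]\<close>, all derivatives of order below \<open>n\<close> vanish
  at both endpoints.\<close>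

lemma power_dvd_higher_pderiv:
  fixes q :: "real poly"
  assumes "j \<le> n"
  shows "q ^ (n - j) dvd (pderiv ^^ j) (q ^ n)"
  using assms
proof (induction j)
  case 0
  then show ?case by simp
next
  case (Suc j)
  define l where "l = n - Suc j"
  have l: "n - j = Suc l" using Suc.prems by (simp add: l_def)
  with Suc obtain r where r: "(pderiv ^^ j) (q ^ n) = q ^ Suc l * r"
    by (auto elim: dvdE)
  have "q ^ l dvd pderiv (q ^ Suc l * r)"
    unfolding pderiv_mult pderiv_power_Suc
    by (intro dvd_add) (simp_all add: dvd_smult mult.assoc dvd_mult dvd_mult2)
  then show ?case by (simp add: r l_def)
qed

lemma higher_pderiv_endpoint_root:
  assumes "j < n" "z\<^sup>2 = 1"
  shows "poly ((pderiv ^^ j) ([:-1, 0, 1:] ^ n)) (z::real) = 0"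
proof -
  have "[:-1, 0, 1:] dvd [:-1, 0, 1::real:] ^ (n - j)"
    using assms by (intro dvd_power) auto
  also have "\<dots> dvd (pderiv ^^ j) ([:-1, 0, 1:] ^ n)"
    using assms by (intro power_dvd_higher_pderiv) simp
  finally show ?thesis
    using assms by (auto elim!: dvdE simp: power2_eq_square)
qed

text \<open>As long as \<open>j < n\<close>, the endpoints -1 and 1 are zeros as well, so
  \<open>j\<close> interior zeros become \<open>j + 2\<close> zeros, and Rolle's theorem leaves
  \<open>j + 1\<close> interior zeros of the next derivative. For \<open>j = n\<close> these are the
  zeros of the Legendre polynomial.\<close>

lemma higher_pderiv_roots:
  assumes "j \<le> n"
  shows "\<exists>B. finite B \<and> card B = j \<and> B \<subseteq> {-1<..<1} \<and>
             (\<forall>y\<in>B. poly ((pderiv ^^ j) ([:-1, 0, 1:] ^ n)) (y::real) = 0)"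
  using assms
proof (induction j)
  case 0
  then show ?case by (intro exI[of _ "{}"]) simp
next
  case (Suc j)
  define P where "P = (pderiv ^^ j) ([:-1, 0, 1::real:] ^ n)"
  from Suc obtain B where B: "finite B" "card B = j" "B \<subseteq> {-1<..<1}" "\<forall>y\<in>B. poly P y = 0"
    unfolding P_def by (meson Suc_leD)
  define A where "A = insert (-1) (insert 1 B)"
  have notin: "- 1 \<notin> insert 1 B" "1 \<notin> B"
    using B(3) by auto
  have "poly P (-1) = 0" "poly P 1 = 0"
    using Suc.prems unfolding P_def by (simp_all add: higher_pderiv_endpoint_root)
  with B(4) have "poly P y = 0" if "y \<in> A" for y
    using that by (auto simp: A_def)
  moreover have "finite A" "A \<noteq> {}" and card: "card A = Suc (Suc j)"
    using B notin by (simp_all add: A_def)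
  ultimately obtain C where C: "finite C" "card A = Suc (card C)"
    "\<forall>y\<in>C. poly (pderiv P) y = 0 \<and> (\<exists>a\<in>A. a < y) \<and> (\<exists>a\<in>A. y < a)"
    using Rolle_roots[of A P] by auto
  have "A \<subseteq> {-1..1}"
    using B(3) by (auto simp: A_def)
  with C(3) have "C \<subseteq> {-1<..<1}"
    by force
  moreover have "card C = Suc j"
    using C(2) card by simp
  moreover have "\<forall>y\<in>C. poly ((pderiv ^^ Suc j) ([:-1, 0, 1:] ^ n)) y = 0"
    using C(3) by (simp add: P_def)
  ultimately show ?case
    using C(1) by (intro exI[of _ C] conjI)
qed

lemma degree_legendre: "degree (legendre n) = n"
  by (simp add: legendre_def degree_higher_pderiv degree_power_eq)

text \<open>Integrate by parts \<open>j\<close> times, until \<open>q\<close> is differentiated to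
  zero; the boundary terms vanish because the derivatives of lower order vanish at the
  endpoints.\<close>

lemma higher_pderiv_orthogonal:
  fixes q :: "real poly"
  assumes "j \<le> n" "q = 0 \<or> degree q < j"
  shows "integral {-1..1} (poly ((pderiv ^^ j) ([:-1, 0, 1:] ^ n) * q)) = 0"
  using assms
proof (induction j arbitrary: q)
  case 0
  then show ?case by simp
next
  case (Suc j)
  let ?w = "(pderiv ^^ j) ([:-1, 0, 1::real:] ^ n)"
  have "integral {-1..1} (poly (pderiv ?w * q)) = - integral {-1..1} (poly (?w * pderiv q))"
    using Suc.prems by (intro integral_poly_by_parts) (simp_all add: higher_pderiv_endpoint_root)
  \<comment> \<open>The derivative of a constant is the zero polynomial, whose degree is 0 by
    convention; the disjunct \<open>q = 0\<close> keeps the induction going down to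
    \<open>j = 0\<close>.\<close>
  also have "pderiv q = 0 \<or> degree (pderiv q) < j"
    using Suc.prems(2) by (cases "degree q") (auto simp: degree_pderiv pderiv_eq_0_iff)
  then have "integral {-1..1} (poly (?w * pderiv q)) = 0"
    using Suc.prems(1) by (intro Suc.IH) simp_all
  finally show ?case by simp
qed

lemma legendre_orthogonal:
  assumes "degree q < n"
  shows "integral {-1..1} (poly (legendre n * q)) = 0"
proof -
  have "legendre n * q =
        (pderiv ^^ n) ([:-1, 0, 1:] ^ n) * smult (1 / (2 ^ n * fact n)) q"
    by (simp add: legendre_def)
  then show ?thesis
    using higher_pderiv_orthogonal[of n n "smult (1 / (2 ^ n * fact n)) q"] assms
    by simp
qed

text \<open>The degree allows at most \<open>k + 1\<close> nodes. Conversely, Rolle's theorem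
  applied to the \<open>k\<close> zeros of the Legendre polynomial gives \<open>k - 1\<close> zeros
  of its derivative in the open interval, and the endpoints add two. For \<open>k = 0\<close> the
  node polynomial would be zero and every real number a node.\<close>

lemma
  assumes "k \<ge> 1"
  shows finite_gl_nodes: "finite (gl_nodes k)"
    and card_gl_nodes: "card (gl_nodes k) = Suc k"
    and gl_nodes_subset: "gl_nodes k \<subseteq> {-1..1}"
    and degree_gl_poly: "degree ([:-1, 0, 1:] * pderiv (legendre k)) = Suc k"
proof -
  let ?\<omega> = "[:-1, 0, 1:] * pderiv (legendre k)"
  have nz: "pderiv (legendre k) \<noteq> 0"
    using assms by (simp add: pderiv_eq_0_iff degree_legendre)
  then show deg: "degree ?\<omega> = Suc k"
    using assms by (subst degree_mult_eq) (auto simp: degree_pderiv degree_legendre)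
  have \<omega>: "?\<omega> \<noteq> 0"
    using deg by force
  show fin: "finite (gl_nodes k)"
    unfolding gl_nodes_def by (rule poly_roots_finite[OF \<omega>])
  have le: "card (gl_nodes k) \<le> Suc k"
    unfolding gl_nodes_def deg[symmetric] by (rule card_poly_roots_bound[OF \<omega>])
  obtain A where A: "finite A" "card A = k" "A \<subseteq> {-1<..<1}"
    "\<And>y. y \<in> A \<Longrightarrow> poly (legendre k) y = 0"
    using higher_pderiv_roots[of k k] by (auto simp: legendre_def)
  moreover have "A \<noteq> {}" using A assms by auto
  ultimately obtain B where B: "finite B" "k = Suc (card B)"
    "\<And>y. y \<in> B \<Longrightarrow> poly (pderiv (legendre k)) y = 0 \<and> (\<exists>a\<in>A. a < y) \<and> (\<exists>a\<in>A. y < a)"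
    by (metis Rolle_roots)
  have sub: "B \<subseteq> {-1<..<1}"
    using A(3) B(3) by force
  define C where "C = insert (-1) (insert 1 B)"
  have "- 1 \<notin> insert 1 B" "1 \<notin> B"
    using sub by auto
  then have "card C = Suc k"
    using B by (simp add: C_def)
  moreover have "C \<subseteq> gl_nodes k"
    using B(3) by (auto simp: C_def gl_nodes_def)
  ultimately have eq: "gl_nodes k = C"
    using fin le by (metis card_subset_eq card_mono le_antisym)
  then show "card (gl_nodes k) = Suc k" "gl_nodes k \<subseteq> {-1..1}"
    using \<open>card C = Suc k\<close> sub by (auto simp: C_def)
qed

lemma endpoints_in_gl_nodes: "-1 \<in> gl_nodes k" "1 \<in> gl_nodes k"
  by (simp_all add: gl_nodes_def)

section \<open>Lagrange interpolation, exactness and positive weights\<close>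

lemma degree_lagrange_basis:
  assumes "finite A" "z \<in> A"
  shows "degree (lagrange_basis A z) < card A"
proof -
  have "card A > 0"
    using assms by (auto simp: card_gt_0_iff)
  have "degree (lagrange_basis A z) \<le> (\<Sum>y\<in>A - {z}. degree (smult (1 / (z - y)) [:- y, 1:]))"
    unfolding lagrange_basis_def using assms(1)
    by (intro order.trans[OF degree_prod_sum_le]) (simp_all add: o_def)
  also have "\<dots> \<le> (\<Sum>y\<in>A - {z}. 1)"
    by (intro sum_mono) (auto simp: degree_smult_le)
  also have "\<dots> < card A"
    using assms \<open>card A > 0\<close> by (simp add: card_Diff_singleton)
  finally show ?thesis .
qed

lemma poly_lagrange_basis:
  assumes "finite A" "z \<in> A" "y \<in> A"
  shows "poly (lagrange_basis A z) y = (if y = z then 1 else 0)"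
proof (cases "y = z")
  case True
  have "poly (smult (1 / (z - y)) [:- y, 1:]) z = 1" if "y \<noteq> z" for y
  proof -
    have "poly (smult c [:- y, 1:]) z = c * (z - y)" for c
      by (simp add: algebra_simps)
    from this[of "1 / (z - y)"] that show ?thesis by simp
  qed
  then have "poly (lagrange_basis A z) z = (\<Prod>y\<in>A - {z}. 1)"
    unfolding lagrange_basis_def poly_prod by (intro prod.cong) blast+
  with True show ?thesis by simp
next
  case False
  then show ?thesis
    unfolding lagrange_basis_def poly_prod using assms by (auto intro!: bexI[of _ y])
qed

lemma poly_lagrange_interpolation:
  assumes "finite A" "degree p < card A"
  shows "p = (\<Sum>z\<in>A. smult (poly p z) (lagrange_basis A z))"
proof (rule poly_eqI_degree[of A])
  have "degree (smult (poly p z) (lagrange_basis A z)) \<le> card A - 1" if "z \<in> A" for z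
    using degree_lagrange_basis[OF assms(1) that] degree_smult_le[of "poly p z" "lagrange_basis A z"]
    by linarith
  then have "degree (\<Sum>z\<in>A. smult (poly p z) (lagrange_basis A z)) \<le> card A - 1"
    using assms by (intro degree_sum_le) auto
  with assms show "degree (\<Sum>z\<in>A. smult (poly p z) (lagrange_basis A z)) < card A"
    by linarith
  fix y assume "y \<in> A"
  then show "poly p y = poly (\<Sum>z\<in>A. smult (poly p z) (lagrange_basis A z)) y"
    using assms by (simp add: poly_sum poly_lagrange_basis if_distrib cong: if_cong sum.cong)
qed (use assms in auto)

text \<open>Divide by the node polynomial \<omega>. The remainder agrees with \<open>p\<close> at
  the nodes and is integrated exactly by the choice of the weights. The multiple of \<omega>
  vanishes at the nodes, and its integral is zero: integration by parts moves the derivative off the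
  Legendre polynomial onto a factor of degree at most \<open>k\<close>, after which orthogonality
  applies.\<close>

lemma gl_quadrature_exact:
  assumes "k \<ge> 1" "degree p \<le> 2 * k - 1"
  shows "(\<Sum>z\<in>gl_nodes k. gl_weight k z * poly p z) = integral {-1..1} (poly p)"
proof -
  define \<omega> where "\<omega> = [:-1, 0, 1:] * pderiv (legendre k)"
  define q r where "q = p div \<omega>" and "r = p mod \<omega>"
  have deg: "degree \<omega> = Suc k"
    unfolding \<omega>_def by (rule degree_gl_poly[OF assms(1)])
  then have \<omega>: "\<omega> \<noteq> 0" by force
  have p: "p = \<omega> * q + r"
    by (simp add: q_def r_def)
  have r: "degree r < Suc k"
    using degree_mod_less[OF \<omega>, of p] deg by (auto simp: r_def)
  have "integral {-1..1} (poly (\<omega> * q)) = 0"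
  proof (cases "q = 0")
    case False
    then have *: "degree (\<omega> * q) = Suc k + degree q"
      using deg \<omega> by (simp add: degree_mult_eq)
    \<comment> \<open>The remainder has degree at most \<open>k\<close> and cannot cancel the
      leading term of \<open>\<omega> * q\<close>. This is where the bound \<open>2 * k - 1\<close>
      enters: it leaves room for the two extra degrees of \<open>s\<close>.\<close>
    then have "degree p = Suc k + degree q"
      unfolding p using r by (subst degree_add_eq_left) auto
    with assms have q: "degree q + 2 \<le> k" by linarith
    define s where "s = [:-1, 0, 1:] * q"
    have "degree s = degree q + 2"
      using False by (simp add: s_def degree_mult_eq del: mult_pCons_left)
    with q have "degree (pderiv s) < k"
      by (simp add: degree_pderiv)
    then have "integral {-1..1} (poly (legendre k * pderiv s)) = 0"
      by (rule legendre_orthogonal)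
    then have "integral {-1..1} (poly (pderiv (legendre k) * s)) = 0"
      by (subst integral_poly_by_parts) (simp_all add: s_def)
    moreover have "\<omega> * q = pderiv (legendre k) * s"
      unfolding \<omega>_def s_def by (metis mult.assoc mult.commute)
    ultimately show ?thesis
      by simp
  next
    case True
    have "poly (0 :: real poly) = (\<lambda>_. 0)"
      by (simp add: fun_eq_iff)
    with True show ?thesis
      by simp
  qed
  then have "integral {-1..1} (poly p) = integral {-1..1} (poly r)"
    using integral_poly_add[of "-1" 1 "\<omega> * q" r] p by simp
  also have "\<dots> = (\<Sum>z\<in>gl_nodes k. poly r z * integral {-1..1} (poly (lagrange_basis (gl_nodes k) z)))"
  proof -
    have "r = (\<Sum>z\<in>gl_nodes k. smult (poly r z) (lagrange_basis (gl_nodes k) z))"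
      using r assms(1)
      by (intro poly_lagrange_interpolation) (simp_all add: finite_gl_nodes card_gl_nodes)
    from arg_cong[OF this, of "\<lambda>r. integral {-1..1} (poly r)"] show ?thesis
      by (simp only: integral_poly_sum_smult[OF finite_gl_nodes[OF assms(1)]])
  qed
  also have "\<dots> = (\<Sum>z\<in>gl_nodes k. gl_weight k z * poly p z)"
  proof (rule sum.cong)
    fix z assume "z \<in> gl_nodes k"
    then have "poly \<omega> z = 0" by (simp add: gl_nodes_def \<omega>_def)
    then show "poly r z * integral {-1..1} (poly (lagrange_basis (gl_nodes k) z)) =
               gl_weight k z * poly p z"
      by (simp add: gl_weight_def p)
  qed simp
  finally show ?thesis ..
qed

lemma gl_weight_pos:
  assumes "k \<ge> 1" "z \<in> gl_nodes k"
  shows "gl_weight k z > 0"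
proof -
  \<comment> \<open>Exactness isolates the weight at \<open>z\<close> when applied to a nonnegative polynomial of degree at most
    \<open>2k - 1\<close> that vanishes at all other nodes.\<close>
  define P where "P = pderiv (legendre k)"
  have P: "degree P = k - 1" "P \<noteq> 0"
    using assms by (auto simp: P_def degree_pderiv degree_legendre pderiv_eq_0_iff)
  have nodes: "y \<in> gl_nodes k \<longleftrightarrow> y = 1 \<or> y = -1 \<or> poly P y = 0" for y
    using square_eq_1_iff[of y] by (auto simp: gl_nodes_def P_def)
  have key: "gl_weight k z > 0"
    if "degree q \<le> 2 * k - 1" "q \<noteq> 0" "\<And>y. y \<in> {-1..1} \<Longrightarrow> poly q y \<ge> 0"
       "\<And>y. y \<in> gl_nodes k - {z} \<Longrightarrow> poly q y = 0" for q
  proof -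
    have "0 < integral {-1..1} (poly q)"
      using that by (intro integral_poly_pos) auto
    also have "\<dots> = (\<Sum>y\<in>gl_nodes k. gl_weight k y * poly q y)"
      by (rule gl_quadrature_exact[symmetric]) (use assms that in auto)
    also have "\<dots> = gl_weight k z * poly q z"
      using assms that finite_gl_nodes[of k] by (subst sum.remove[of _ z]) auto
    finally show ?thesis
      using that(3)[of z] gl_nodes_subset[OF assms(1)] assms(2) by (auto simp: zero_less_mult_iff)
  qed
  consider "z = 1" | "z = -1" | "poly P z = 0" "z \<noteq> 1" "z \<noteq> -1"
    using assms nodes by blast
  then show ?thesis
  proof cases
    case 1
    \<comment> \<open>The linear factor removes the opposite endpoint and the square of
      \<open>P\<close> the interior nodes; the degree is exactly the admissible
      \<open>2 * k - 1\<close>.\<close>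
    have "degree ([:1, 1:] * P\<^sup>2) \<le> 2 * k - 1"
      using P assms by (simp add: degree_mult_eq degree_power_eq del: mult_pCons_left)
    then show ?thesis
      using P nodes 1 by (intro key[of "[:1, 1:] * P\<^sup>2"]) (auto simp del: mult_pCons_left)
  next
    case 2
    have "degree ([:1, -1:] * P\<^sup>2) \<le> 2 * k - 1"
      using P assms by (simp add: degree_mult_eq degree_power_eq del: mult_pCons_left)
    then show ?thesis
      using P nodes 2 by (intro key[of "[:1, -1:] * P\<^sup>2"]) (auto simp del: mult_pCons_left)
  next
    case 3
    then obtain Q where Q: "P = [:-z, 1:] * Q"
      by (auto simp: poly_eq_0_iff_dvd elim: dvdE)
    then have Q0: "Q \<noteq> 0" using P by auto
    have dQ: "Suc (degree Q) = k - 1"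
      using P(1) Q0 unfolding Q by (subst (asm) degree_mult_eq) auto
    \<comment> \<open>For an interior node, \<open>1 - y^2\<close> removes both endpoints and
      \<open>Q\<close> the other interior nodes; since \<open>Q\<close> has degree
      \<open>k - 2\<close>, the total degree is \<open>2 * k - 2\<close>.\<close>
    have "degree ([:1, 0, -1:] * Q\<^sup>2) \<le> 2 * k - 1"
      using Q0 dQ by (simp add: degree_mult_eq degree_power_eq del: mult_pCons_left)
    moreover have "poly ([:1, 0, -1:] * Q\<^sup>2) y = 0" if "y \<in> gl_nodes k - {z}" for y
      using that by (auto simp: nodes Q)
    moreover have "poly ([:1, 0, -1:] * Q\<^sup>2) y \<ge> 0" if "y \<in> {-1..1}" for y
    proof -
      have "poly ([:1, 0, -1:] * Q\<^sup>2) y = (1 - y\<^sup>2) * (poly Q y)\<^sup>2"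
        by (simp add: algebra_simps power2_eq_square)
      then show ?thesis
        using that abs_square_le_1[of y] by (simp add: abs_le_iff)
    qed
    ultimately show ?thesis
      using Q0 by (intro key[of "[:1, 0, -1:] * Q\<^sup>2"]) (auto simp del: mult_pCons_left)
  qed
qed

section \<open>Summation by parts on a cell\<close>

text \<open>Each component of \<open>gl_interp\<close> as a formal polynomial, so that degrees and
  \<open>pderiv\<close> are available.\<close>

definition gl_interp_poly :: "nat \<Rightarrow> real \<Rightarrow> real \<Rightarrow> (real \<Rightarrow> real) \<Rightarrow> real poly" where
  "gl_interp_poly k a b f =
     (\<Sum>p\<in>gl_point a b ` gl_nodes k. smult (f p) (lagrange_basis (gl_point a b ` gl_nodes k) p))"

lemma gl_point_endpoints: "gl_point a b (-1) = a" "gl_point a b 1 = b"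
  by (simp_all add: gl_point_def field_simps)

lemma card_gl_points:
  assumes "k \<ge> 1" "a < b"
  shows "card (gl_point a b ` gl_nodes k) = Suc k"
proof -
  have "inj_on (gl_point a b) (gl_nodes k)"
    using assms(2) by (auto simp: inj_on_def gl_point_def)
  then show ?thesis
    using card_gl_nodes[OF assms(1)] by (simp add: card_image)
qed

lemma gl_point_in_cell:
  assumes "k \<ge> 1" "a \<le> b" "z \<in> gl_nodes k"
  shows "gl_point a b z \<in> {a..b}"
proof -
  have "\<bar>z\<bar> \<le> 1"
    using subsetD[OF gl_nodes_subset[OF assms(1)] assms(3)] by (simp add: abs_le_iff)
  then have "\<bar>(b - a) / 2 * z\<bar> \<le> (b - a) / 2"
    using assms(2) mult_left_mono[of "\<bar>z\<bar>" 1 "(b - a) / 2"] by (simp add: abs_mult)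
  then show ?thesis
    by (auto simp: gl_point_def abs_le_iff field_simps)
qed

lemma degree_gl_interp_poly:
  assumes "k \<ge> 1" "a < b"
  shows "degree (gl_interp_poly k a b f) \<le> k"
  unfolding gl_interp_poly_def
proof (rule degree_sum_le)
  let ?A = "gl_point a b ` gl_nodes k"
  show fin: "finite ?A"
    using finite_gl_nodes[OF assms(1)] by simp
  fix p assume "p \<in> ?A"
  with degree_lagrange_basis[OF fin this] card_gl_points[OF assms]
  show "degree (smult (f p) (lagrange_basis ?A p)) \<le> k"
    using degree_smult_le[of "f p" "lagrange_basis ?A p"] by linarith
qed

lemma poly_gl_interp_poly:
  assumes "k \<ge> 1" "p \<in> gl_point a b ` gl_nodes k"
  shows "poly (gl_interp_poly k a b f) p = f p"
proof -
  have "finite (gl_point a b ` gl_nodes k)"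
    using finite_gl_nodes[OF assms(1)] by simp
  then show ?thesis
    using assms(2)
    by (simp add: gl_interp_poly_def poly_sum poly_lagrange_basis if_distrib cong: if_cong sum.cong)
qed

lemma gl_interp_component: "gl_interp k a b \<psi> y $ l = poly (gl_interp_poly k a b (\<lambda>y. \<psi> y $ l)) y"
  by (simp add: gl_interp_def gl_interp_poly_def poly_sum mult.commute)

lemma gl_interp_node:
  assumes "k \<ge> 1" "p \<in> gl_point a b ` gl_nodes k"
  shows "gl_interp k a b \<psi> p = \<psi> p"
  by (simp add: vec_eq_iff gl_interp_component poly_gl_interp_poly[OF assms])

lemma gl_interp_has_vector_derivative:
  "(gl_interp k a b \<psi> has_vector_derivative
     (\<chi> l. poly (pderiv (gl_interp_poly k a b (\<lambda>y. \<psi> y $ l))) y)) (at y)"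
proof -
  let ?A = "gl_point a b ` gl_nodes k"
  have "((\<lambda>y. poly (lagrange_basis ?A p) y *\<^sub>R \<psi> p) has_vector_derivative
          poly (pderiv (lagrange_basis ?A p)) y *\<^sub>R \<psi> p) (at y)" for p
    by (rule bounded_linear.has_vector_derivative[OF bounded_linear_scaleR_left])
      (rule has_real_derivative_iff_has_vector_derivative[THEN iffD1, OF poly_DERIV])
  then have "(gl_interp k a b \<psi> has_vector_derivative
          (\<Sum>p\<in>?A. poly (pderiv (lagrange_basis ?A p)) y *\<^sub>R \<psi> p)) (at y)"
    unfolding gl_interp_def by (rule has_vector_derivative_sum)
  also have "(\<Sum>p\<in>?A. poly (pderiv (lagrange_basis ?A p)) y *\<^sub>R \<psi> p) =
      (\<chi> l. poly (pderiv (gl_interp_poly k a b (\<lambda>y. \<psi> y $ l))) y)"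
    by (simp add: vec_eq_iff gl_interp_poly_def poly_sum higher_pderiv_sum[of 1, simplified] pderiv_smult mult.commute)
  finally show ?thesis .
qed

lemma continuous_on_gl_interp: "continuous_on A (gl_interp k a b \<psi>)"
  by (intro continuous_at_imp_continuous_on ballI
      has_vector_derivative_continuous[OF gl_interp_has_vector_derivative])

section \<open>Quadrature on a cell and discrete integration by parts\<close>

lemma gl_quad_cong:
  assumes "\<And>p. p \<in> gl_point a b ` gl_nodes k \<Longrightarrow> f p = g p"
  shows "gl_quad k a b f = gl_quad k a b g"
  unfolding gl_quad_def using assms by (intro arg_cong2[where f = "(*)"] sum.cong) auto

lemma gl_quad_add: "gl_quad k a b (\<lambda>y. f y + g y) = gl_quad k a b f + gl_quad k a b g"
  by (simp add: gl_quad_def algebra_simps sum.distrib)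

lemma gl_quad_sum: "gl_quad k a b (\<lambda>y. \<Sum>l\<in>A. f l y) = (\<Sum>l\<in>A. gl_quad k a b (f l))"
  unfolding gl_quad_def sum_distrib_left by (rule sum.swap)

lemma gl_quad_nonneg:
  assumes "k \<ge> 1" "a \<le> b" "\<And>y. y \<in> {a..b} \<Longrightarrow> g y \<ge> 0"
  shows "gl_quad k a b g \<ge> 0"
  unfolding gl_quad_def
  using assms gl_weight_pos[OF assms(1)] gl_point_in_cell[OF assms(1,2)]
  by (intro mult_nonneg_nonneg sum_nonneg) (auto intro: less_imp_le)

text \<open>Pulled back to the reference interval, the derivative has degree at most
  \<open>2 * k - 1\<close>, so exactness turns the quadrature into the fundamental theorem of
  calculus. The scaling factor of the quadrature is the chain rule factor.\<close>

lemma gl_quad_pderiv: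
  assumes "k \<ge> 1" "degree R \<le> 2 * k"
  shows "gl_quad k a b (poly (pderiv R)) = poly R b - poly R a"
proof -
  define R' where "R' = pcompose R [:(a + b) / 2, (b - a) / 2:]"
  have aff: "poly [:(a + b) / 2, (b - a) / 2:] z = gl_point a b z" for z
    by (simp add: gl_point_def)
  have "degree R' \<le> 2 * k"
    using degree_pcompose_le[of R "[:(a + b) / 2, (b - a) / 2:]"] assms(2)
    by (auto simp: R'_def split: if_splits)
  then have deg: "degree (pderiv R') \<le> 2 * k - 1"
    by (simp add: degree_pderiv)
  have "gl_quad k a b (poly (pderiv R)) = (\<Sum>z\<in>gl_nodes k. gl_weight k z * poly (pderiv R') z)"
    unfolding gl_quad_def R'_def pderiv_pcompose poly_mult poly_pcompose aff sum_distrib_left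
    by (simp add: pderiv_pCons mult_ac)
  also have "\<dots> = poly R' 1 - poly R' (-1)"
    using gl_quadrature_exact[OF assms(1) deg] by (simp add: integral_poly_pderiv)
  also have "\<dots> = poly R b - poly R a"
    unfolding R'_def poly_pcompose aff gl_point_endpoints ..
  finally show ?thesis .
qed

text \<open>The functions \<open>f\<close> and \<open>g\<close> are arbitrary: at the nodes they
  agree with their interpolants, so the two integrands add up there to the derivative of a sum of
  products of interpolants. The endpoints are nodes, hence the boundary values are those of
  \<open>f\<close> and \<open>g\<close> themselves.\<close>

lemma gl_summation_by_parts:
  fixes f g :: "real \<Rightarrow> real ^ 'm"
  assumes "k \<ge> 1" "a < b"
  shows "gl_quad k a b (\<lambda>y. f y \<bullet> vector_derivative (gl_interp k a b g) (at y))
       + gl_quad k a b (\<lambda>y. g y \<bullet> vector_derivative (gl_interp k a b f) (at y))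
       = f b \<bullet> g b - f a \<bullet> g a"
proof -
  define P where "P h l = gl_interp_poly k a b (\<lambda>y. h y $ l)" for h :: "real \<Rightarrow> real ^ 'm" and l
  have nodes: "poly (P h l) p = h p $ l" if "p \<in> gl_point a b ` gl_nodes k" for h l p
    unfolding P_def by (rule poly_gl_interp_poly[OF assms(1) that])
  have deriv: "vector_derivative (gl_interp k a b h) (at y) = (\<chi> l. poly (pderiv (P h l)) y)" for h y
    unfolding P_def by (rule vector_derivative_at[OF gl_interp_has_vector_derivative])
  have ends: "a \<in> gl_point a b ` gl_nodes k" "b \<in> gl_point a b ` gl_nodes k"
    using imageI[OF endpoints_in_gl_nodes(1), of "gl_point a b" k]
      imageI[OF endpoints_in_gl_nodes(2), of "gl_point a b" k]
    by (simp_all only: gl_point_endpoints)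
  have deg: "degree (P f l * P g l) \<le> 2 * k" for l
  proof -
    have "degree (P f l) \<le> k" "degree (P g l) \<le> k"
      unfolding P_def by (rule degree_gl_interp_poly[OF assms])+
    with degree_mult_le[of "P f l" "P g l"] show ?thesis
      by linarith
  qed
  have "gl_quad k a b (\<lambda>y. f y \<bullet> vector_derivative (gl_interp k a b g) (at y))
       + gl_quad k a b (\<lambda>y. g y \<bullet> vector_derivative (gl_interp k a b f) (at y))
       = gl_quad k a b (\<lambda>y. \<Sum>l\<in>UNIV. poly (pderiv (P f l * P g l)) y)"
    unfolding gl_quad_add[symmetric]
    by (rule gl_quad_cong) (simp add: deriv inner_vec_def pderiv_mult nodes sum.distrib)
  also have "\<dots> = (\<Sum>l\<in>UNIV. poly (P f l * P g l) b - poly (P f l * P g l) a)"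
    by (simp only: gl_quad_sum gl_quad_pderiv[OF assms(1) deg])
  also have "\<dots> = f b \<bullet> g b - f a \<bullet> g a"
    by (simp add: inner_vec_def sum_subtractf nodes[OF ends(1)] nodes[OF ends(2)])
  finally show ?thesis .
qed

section \<open>Monotonicity of gradients and traces of the discrete solution\<close>

text \<open>Along the segment from \<open>p\<close> to \<open>q\<close> convexity bounds the
  difference quotient of \<open>e\<close> at \<open>p\<close> by \<open>e q - e p\<close>; let the
  step tend to zero. The segment stays in \<open>S\<close>, so a derivative within \<open>S\<close>
  suffices.\<close>

lemma gradient_on_tangent:
  assumes "convex_on S e" "gradient_on S e \<xi>" "p \<in> S" "q \<in> S"
  shows "e p + \<xi> p \<bullet> (q - p) \<le> e q"
proof -
  define c where "c h = p + h *\<^sub>R (q - p)" for h :: real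
  have c: "c h = (1 - h) *\<^sub>R p + h *\<^sub>R q" for h
    by (simp add: c_def algebra_simps)
  have "convex S" using assms(1) by (rule convex_on_imp_convex)
  then have sub: "c ` {0..1} \<subseteq> S"
    using assms(3,4) by (auto simp: c intro!: convexD)
  have "(c has_derivative (\<lambda>h. h *\<^sub>R (q - p))) (at 0 within {0..1})"
    unfolding c_def by (auto intro!: derivative_eq_intros)
  moreover have "(e has_derivative (\<lambda>z. \<xi> p \<bullet> z)) (at (c 0) within c ` {0..1})"
    using assms sub by (auto simp: gradient_on_def c_def intro: has_derivative_subset)
  ultimately have "((\<lambda>h. e (c h)) has_derivative (\<lambda>h. \<xi> p \<bullet> (h *\<^sub>R (q - p)))) (at 0 within {0..1})"
    by (rule has_derivative_in_compose)
  then have "((\<lambda>h. e (c h)) has_real_derivative \<xi> p \<bullet> (q - p)) (at 0 within {0..1})"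
    by (simp add: has_field_derivative_def mult_commute_abs)
  then have lim: "((\<lambda>h. (e (c h) - e p) / h) \<longlongrightarrow> \<xi> p \<bullet> (q - p)) (at 0 within {0..1})"
    by (simp add: has_field_derivative_iff c_def)
  have "(e (c h) - e p) / h \<le> e q - e p" if "h \<in> {0..1}" "h \<noteq> 0" for h
  proof -
    have "e (c h) \<le> (1 - h) * e p + h * e q"
      unfolding c using assms that by (intro convex_onD) auto
    then have "e (c h) - e p \<le> (e q - e p) * h"
      by (simp add: algebra_simps)
    moreover have "h > 0" using that by simp
    ultimately show ?thesis by (simp only: pos_divide_le_eq)
  qed
  then have "eventually (\<lambda>h. (e (c h) - e p) / h \<le> e q - e p) (at 0 within {0..1})"
    by (auto simp: eventually_at_filter)
  with lim have "\<xi> p \<bullet> (q - p) \<le> e q - e p"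
    by (rule tendsto_upperbound) (simp add: trivial_limit_within islimpt_Icc)
  then show ?thesis by simp
qed

text \<open>Add the tangent inequalities at \<open>p\<close> and at \<open>q\<close>.\<close>

lemma gradient_on_monotone:
  assumes "convex_on S e" "gradient_on S e \<xi>" "p \<in> S" "q \<in> S"
  shows "(\<xi> q - \<xi> p) \<bullet> (q - p) \<ge> 0"
  using gradient_on_tangent[OF assms] gradient_on_tangent[OF assms(1,2,4,3)]
  by (simp add: inner_diff_left inner_diff_right)

section \<open>One-sided limits and their time derivatives\<close>

text \<open>\<open>on_cells\<close> is a limit from inside the open cell. A continuous extension to
  the closed cell supplies its value, and the limit is unique because every point of the closed
  cell, endpoints included, is a limit point of the open one.\<close>

lemma on_cells_eq:
  assumes "x (i - 1) < x i" "y \<in> {x (i - 1)..x i}" "continuous_on {x (i - 1)..x i} g"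
    and "\<And>y. y \<in> cell x i \<Longrightarrow> f y = g y"
  shows "on_cells x f i y = g y"
  unfolding on_cells_def
proof (rule tendsto_Lim)
  have "y islimpt cell x i"
    using assms(1,2) unfolding cell_def
    by (cases "y = x (i - 1)"; cases "y = x i")
      (auto simp: islimpt_greaterThanLessThan1 islimpt_greaterThanLessThan2 intro: interior_limit_point)
  then show "\<not> trivial_limit (at y within cell x i)"
    by (simp add: trivial_limit_within)
  have "(g \<longlongrightarrow> g y) (at y within {x (i - 1)..x i})"
    using assms(2,3) by (simp add: continuous_on_def)
  then have "(g \<longlongrightarrow> g y) (at y within cell x i)"
    by (rule tendsto_within_subset) (auto simp: cell_def)
  then show "(f \<longlongrightarrow> g y) (at y within cell x i)"
    by (rule Lim_transform_within[OF _ zero_less_one]) (simp add: assms(4))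
qed

text \<open>The coefficients do not depend on \<open>v\<close>, so the same linear combination of
  point values serves at all times and can be differentiated in time.\<close>

lemma dg_space_lagrange:
  assumes "v \<in> dg_space N x k" "i \<in> {1..N}" "finite Q" "Q \<subseteq> cell x i" "card Q = Suc k" "y \<in> cell x i"
  shows "v y = (\<Sum>q\<in>Q. poly (lagrange_basis Q q) y *\<^sub>R v q)"
proof (rule vec_eq_iff[THEN iffD2], rule allI)
  fix l
  obtain p where p: "degree p \<le> k" "\<And>y. y \<in> cell x i \<Longrightarrow> v y $ l = poly p y"
    using assms(1,2) unfolding dg_space_def by blast
  have "v y $ l = poly (\<Sum>q\<in>Q. smult (poly p q) (lagrange_basis Q q)) y"
    using poly_lagrange_interpolation[OF assms(3), of p] p assms(5,6) by simp
  also have "\<dots> = (\<Sum>q\<in>Q. poly (lagrange_basis Q q) y *\<^sub>R v q) $ l"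
    using p(2) assms(4) by (auto simp: poly_sum mult.commute intro!: sum.cong)
  finally show "v y $ l = (\<Sum>q\<in>Q. poly (lagrange_basis Q q) y *\<^sub>R v q) $ l" .
qed

lemma on_cells_has_vector_derivative:
  fixes \<rho> :: "real \<Rightarrow> real \<Rightarrow> real ^ 'm"
  assumes "x (i - 1) < x i" "i \<in> {1..N}" "y \<in> {x (i - 1)..x i}"
    and "t \<in> T" "at t within T \<noteq> bot"
    and dg: "\<And>s. s \<in> T \<Longrightarrow> \<rho> s \<in> dg_space N x k"
    and diff: "\<And>y. y \<in> cell x i \<Longrightarrow> (\<lambda>s. \<rho> s y) differentiable (at t within T)"
  shows "((\<lambda>s. on_cells x (\<rho> s) i y) has_vector_derivative
           on_cells x (\<lambda>y. vector_derivative (\<lambda>s. \<rho> s y) (at t within T)) i y) (at t within T)"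
proof -
  \<comment> \<open>Differentiability in time is given only at interior points; the limits at the cell ends are
    fixed linear combinations of values at \<open>k + 1\<close> interior points.\<close>
  have "infinite (cell x i)"
    using assms(1) by (simp add: cell_def infinite_Ioo)
  from infinite_arbitrarily_large[OF this]
  obtain Q where Q: "finite Q" "card Q = Suc k" "Q \<subseteq> cell x i"
    by blast
  define \<rho>' where "\<rho>' y = vector_derivative (\<lambda>s. \<rho> s y) (at t within T)" for y
  let ?I = "\<lambda>v y. \<Sum>q\<in>Q. poly (lagrange_basis Q q) y *\<^sub>R v q"
  have cont: "continuous_on {x (i - 1)..x i} (?I v)" for v :: "real \<Rightarrow> real ^ 'm"
    by (intro continuous_intros)
  have repr: "\<rho> s y = ?I (\<rho> s) y" if "s \<in> T" "y \<in> cell x i" for s y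
    by (rule dg_space_lagrange[OF dg[OF that(1)] assms(2) Q(1,3,2) that(2)])
  have I': "((\<lambda>s. ?I (\<rho> s) y) has_vector_derivative ?I \<rho>' y) (at t within T)" for y
  proof (rule has_vector_derivative_sum)
    fix q assume "q \<in> Q"
    then have "(\<lambda>s. \<rho> s q) differentiable (at t within T)"
      using Q(3) diff by blast
    then have "((\<lambda>s. \<rho> s q) has_vector_derivative \<rho>' q) (at t within T)"
      unfolding \<rho>'_def by (simp add: vector_derivative_works)
    then show "((\<lambda>s. poly (lagrange_basis Q q) y *\<^sub>R \<rho> s q) has_vector_derivative
        poly (lagrange_basis Q q) y *\<^sub>R \<rho>' q) (at t within T)"
      by (rule bounded_linear.has_vector_derivative[OF bounded_linear_scaleR_right])
  qed
  \<comment> \<open>Uniqueness of the time derivative shows that it is itself given by a polynomial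
    in space, hence has limits at the cell ends.\<close>
  have "\<rho>' y = ?I \<rho>' y" if "y \<in> cell x i" for y
    unfolding \<rho>'_def[of y]
  proof (rule vector_derivative_within[OF assms(5)])
    show "((\<lambda>s. \<rho> s y) has_vector_derivative ?I \<rho>' y) (at t within T)"
      by (rule has_vector_derivative_transform[OF assms(4) _ I']) (rule repr[OF _ that])
  qed
  then have "on_cells x \<rho>' i y = ?I \<rho>' y"
    by (intro on_cells_eq[OF assms(1,3) cont])
  moreover have "on_cells x (\<rho> s) i y = ?I (\<rho> s) y" if "s \<in> T" for s
    by (rule on_cells_eq[OF assms(1,3) cont]) (rule repr[OF that])
  ultimately show ?thesis
    unfolding \<rho>'_def[symmetric]
    using has_vector_derivative_transform[OF assms(4) _ I'[of y], of "\<lambda>s. on_cells x (\<rho> s) i y"]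
    by simp
qed

section \<open>Entropy balance\<close>

lemma gl_interp_in_dg_space:
  assumes "k \<ge> 1" "a < b"
  shows "gl_interp k a b w \<in> dg_space N x k"
  using degree_gl_interp_poly[OF assms] by (fastforce simp: dg_space_def gl_interp_component)

text \<open>The scheme sees a test function only through its values at the nodes, so
  \<open>w\<close> need not be polynomial; this admits \<xi> and \<open>F u\<close> of the discrete
  solution. Leaving \<open>A\<close>, \<open>B\<close> and \<open>fl\<close> open covers both
  equations of the scheme.\<close>

lemma weak_form_on_cell:
  fixes A B :: "nat \<Rightarrow> real \<Rightarrow> real ^ 'm"
  assumes weak: "\<forall>\<phi>\<in>dg_space N x k. \<forall>i\<in>{1..N}.
        cell_quad k x i (\<lambda>y. A i y \<bullet> on_cells x \<phi> i y) =
        - cell_quad k x i (\<lambda>y. B i y \<bullet> interp_deriv k x i (on_cells x \<phi> i) y)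
        + fl i \<bullet> trace_minus N x (on_cells x \<phi>) i
        - fl (i - 1) \<bullet> trace_plus N x (on_cells x \<phi>) (i - 1)"
    and k: "k \<ge> 1" and i: "i \<in> {1..N}" and mesh: "x (i - 1) < x i"
  shows "cell_quad k x i (\<lambda>y. A i y \<bullet> w y) =
        - cell_quad k x i (\<lambda>y. B i y \<bullet> interp_deriv k x i w y)
        + fl i \<bullet> w (x i) - fl (i - 1) \<bullet> w (x (i - 1))"
proof -
  let ?P = "gl_point (x (i - 1)) (x i) ` gl_nodes k"
  \<comment> \<open>Only cell \<open>i\<close> matters, so a single polynomial on the whole line serves as test function.\<close>
  define \<phi> where "\<phi> = gl_interp k (x (i - 1)) (x i) w"
  have "\<phi> \<in> dg_space N x k"
    unfolding \<phi>_def by (rule gl_interp_in_dg_space[OF k mesh])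
  moreover have nodes: "on_cells x \<phi> i p = w p" if "p \<in> ?P" for p
  proof -
    have "p \<in> {x (i - 1)..x i}"
      using that gl_point_in_cell[OF k less_imp_le[OF mesh]] by blast
    then have "on_cells x \<phi> i p = \<phi> p"
      unfolding \<phi>_def by (intro on_cells_eq[OF mesh _ continuous_on_gl_interp]) simp_all
    then show ?thesis
      unfolding \<phi>_def using gl_interp_node[OF k that] by simp
  qed
  have ends: "x (i - 1) \<in> ?P" "x i \<in> ?P"
    using imageI[OF endpoints_in_gl_nodes(1), of "gl_point (x (i - 1)) (x i)" k]
      imageI[OF endpoints_in_gl_nodes(2), of "gl_point (x (i - 1)) (x i)" k]
    by (simp_all only: gl_point_endpoints)
  have "gl_interp k (x (i - 1)) (x i) (on_cells x \<phi> i) = gl_interp k (x (i - 1)) (x i) w"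
    by (rule ext) (simp only: gl_interp_def nodes cong: sum.cong)
  then have "interp_deriv k x i (on_cells x \<phi> i) = interp_deriv k x i w"
    by (intro ext) (simp only: interp_deriv_def)
  moreover have "cell_quad k x i (\<lambda>y. A i y \<bullet> on_cells x \<phi> i y) = cell_quad k x i (\<lambda>y. A i y \<bullet> w y)"
    unfolding cell_quad_def by (rule gl_quad_cong) (simp add: nodes)
  \<comment> \<open>Since \<open>1 \<le> i \<le> N\<close>, the periodic branches at
    \<open>i = 0\<close> and at \<open>i - 1 = N\<close> do not occur, and both traces come from
    cell \<open>i\<close>.\<close>
  moreover have "trace_minus N x (on_cells x \<phi>) i = w (x i)"
    using i nodes[OF ends(2)] by (simp add: trace_minus_def)
  moreover have "trace_plus N x (on_cells x \<phi>) (i - 1) = w (x (i - 1))"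
    using i nodes[OF ends(1)] by (auto simp: trace_plus_def)
  ultimately show ?thesis
    using weak[THEN bspec, of \<phi>, THEN bspec, OF _ i] by simp
qed

lemma sum_shift_periodic:
  fixes p :: "nat \<Rightarrow> real"
  assumes "p 0 = p N"
  shows "(\<Sum>i=1..N. p (i - 1)) = (\<Sum>i=1..N. p i)"
proof -
  have "(\<Sum>i=1..N. p i) - (\<Sum>i=1..N. p (i - 1)) = p N - p 0"
    by (induction N) simp_all
  with assms show ?thesis by simp
qed

text \<open>Valid for any periodic, single-valued fluxes: their choice enters only through the sum
  over interfaces.\<close>

lemma entropy_balance:
  assumes k: "k \<ge> 1" and mesh: "\<forall>i\<in>{1..N}. x (i - 1) < x i"
    and S1: "S1 N x k F \<rho>t \<rho> u Fuhat" and S2: "S2 N x k \<xi> \<rho> u xihat"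
    and periodic: "Fuhat 0 = Fuhat N" "xihat 0 = xihat N"
  defines "X \<equiv> xi_h x \<xi> \<rho>" and "M \<equiv> matvec_h x F \<rho> u"
  shows "domain_quad N x k (\<lambda>i y. on_cells x \<rho>t i y \<bullet> X i y) =
         - dissipation N x k F \<rho> u
         + (\<Sum>i=1..N. trace_plus N x X i \<bullet> trace_plus N x M i - trace_minus N x X i \<bullet> trace_minus N x M i
              - Fuhat i \<bullet> jump N x X i - xihat i \<bullet> jump N x M i)"
proof -
  \<comment> \<open>\<open>m i\<close> is the contribution to interface \<open>i\<close> of the cell
    on its left, and \<open>p i\<close>, with a minus sign, that of the cell on its right.\<close>
  define m where "m i = Fuhat i \<bullet> trace_minus N x X i + xihat i \<bullet> trace_minus N x M i
      - trace_minus N x X i \<bullet> trace_minus N x M i" for i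
  define p where "p i = Fuhat i \<bullet> trace_plus N x X i + xihat i \<bullet> trace_plus N x M i
      - trace_plus N x X i \<bullet> trace_plus N x M i" for i
  have cells: "cell_quad k x i (\<lambda>y. on_cells x \<rho>t i y \<bullet> X i y)
        + cell_quad k x i (\<lambda>y. on_cells x u i y \<bullet> M i y) = m i - p (i - 1)"
    if i: "i \<in> {1..N}" for i
  proof -
    have 1: "cell_quad k x i (\<lambda>y. on_cells x \<rho>t i y \<bullet> X i y) =
        - cell_quad k x i (\<lambda>y. M i y \<bullet> interp_deriv k x i (X i) y)
        + Fuhat i \<bullet> X i (x i) - Fuhat (i - 1) \<bullet> X i (x (i - 1))"
      unfolding M_def by (rule weak_form_on_cell[OF S1[unfolded S1_def] k i mesh[rule_format, OF i]])
    have 2: "cell_quad k x i (\<lambda>y. on_cells x u i y \<bullet> M i y) =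
        - cell_quad k x i (\<lambda>y. X i y \<bullet> interp_deriv k x i (M i) y)
        + xihat i \<bullet> M i (x i) - xihat (i - 1) \<bullet> M i (x (i - 1))"
      unfolding X_def by (rule weak_form_on_cell[OF S2[unfolded S2_def] k i mesh[rule_format, OF i]])
    have 3: "cell_quad k x i (\<lambda>y. M i y \<bullet> interp_deriv k x i (X i) y)
        + cell_quad k x i (\<lambda>y. X i y \<bullet> interp_deriv k x i (M i) y)
        = M i (x i) \<bullet> X i (x i) - M i (x (i - 1)) \<bullet> X i (x (i - 1))"
      unfolding cell_quad_def interp_deriv_def by (rule gl_summation_by_parts[OF k mesh[rule_format, OF i]])
    have tr: "trace_minus N x w i = w i (x i)" "trace_plus N x w (i - 1) = w i (x (i - 1))"
      for w :: "nat \<Rightarrow> real \<Rightarrow> real ^ 'a"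
      using i by (auto simp: trace_minus_def trace_plus_def)
    show ?thesis
      unfolding m_def p_def tr using 1 2 3 by (simp add: inner_commute)
  qed
  have "p 0 = p N"
    using periodic by (cases "N = 0") (simp_all add: p_def trace_plus_def)
  from sum_shift_periodic[OF this]
  have "(\<Sum>i=1..N. m i - p (i - 1)) = (\<Sum>i=1..N. m i - p i)"
    by (simp add: sum_subtractf)
  moreover have "domain_quad N x k (\<lambda>i y. on_cells x \<rho>t i y \<bullet> X i y) + dissipation N x k F \<rho> u
      = (\<Sum>i=1..N. m i - p (i - 1))"
    unfolding dissipation_def domain_quad_def M_def[symmetric] sum.distrib[symmetric]
    by (rule sum.cong[OF refl cells])
  moreover have "m i - p i = trace_plus N x X i \<bullet> trace_plus N x M i
      - trace_minus N x X i \<bullet> trace_minus N x M i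
      - Fuhat i \<bullet> jump N x X i - xihat i \<bullet> jump N x M i" for i
    by (simp add: m_def p_def jump_def inner_diff_right)
  ultimately show ?thesis by simp
qed

lemma traces_periodic:
  assumes "N \<ge> 1"
  shows "trace_plus N x w 0 = trace_plus N x w N" "trace_minus N x w 0 = trace_minus N x w N"
  using assms by (simp_all add: trace_plus_def trace_minus_def)

section \<open>Time derivative of the entropy and signs of the terms\<close>

text \<open>Nodes and weights are fixed in time, so the chain rule applies node by node. As
  \<open>e\<close> is differentiable only within \<open>S\<close>, its derivative is restricted to
  the range of the nodal value over \<open>T\<close>, which lies in \<open>S\<close>.\<close>

lemma discrete_entropy_has_derivative:
  fixes \<rho> :: "real \<Rightarrow> real \<Rightarrow> real ^ 'm"
  assumes k: "k \<ge> 1" and mesh: "\<forall>i\<in>{1..N}. x (i - 1) < x i"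
    and grad: "gradient_on S e \<xi>" and t: "t \<in> T" "at t within T \<noteq> bot"
    and dg: "\<And>s. s \<in> T \<Longrightarrow> \<rho> s \<in> dg_space N x k"
    and S: "\<And>s. s \<in> T \<Longrightarrow> \<forall>i\<in>{1..N}. \<forall>y\<in>{x (i - 1)..x i}. on_cells x (\<rho> s) i y \<in> S"
    and diff: "\<forall>i\<in>{1..N}. \<forall>y\<in>cell x i. (\<lambda>s. \<rho> s y) differentiable (at t within T)"
  shows "((\<lambda>s. discrete_entropy N x k e (\<rho> s)) has_real_derivative
           domain_quad N x k (\<lambda>i y.
             on_cells x (\<lambda>y. vector_derivative (\<lambda>s. \<rho> s y) (at t within T)) i y \<bullet> xi_h x \<xi> (\<rho> t) i y))
         (at t within T)"
  unfolding discrete_entropy_def domain_quad_def cell_quad_def gl_quad_def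
proof (intro DERIV_sum DERIV_cmult)
  fix i z assume i: "i \<in> {1..N}" and z: "z \<in> gl_nodes k"
  define y where "y = gl_point (x (i - 1)) (x i) z"
  have y: "y \<in> {x (i - 1)..x i}"
    unfolding y_def by (rule gl_point_in_cell[OF k less_imp_le[OF mesh[rule_format, OF i]] z])
  define r where "r s = on_cells x (\<rho> s) i y" for s
  define r' where "r' = on_cells x (\<lambda>y. vector_derivative (\<lambda>s. \<rho> s y) (at t within T)) i y"
  have "(r has_vector_derivative r') (at t within T)"
    unfolding r_def r'_def
    by (rule on_cells_has_vector_derivative[OF mesh[rule_format, OF i] i y t dg diff[rule_format, OF i]])
  then have "(r has_derivative (\<lambda>h. h *\<^sub>R r')) (at t within T)"
    by (simp add: has_vector_derivative_def)
  moreover have "(e has_derivative (\<lambda>v. \<xi> (r t) \<bullet> v)) (at (r t) within r ` T)"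
  proof (rule has_derivative_subset)
    show "(e has_derivative (\<lambda>v. \<xi> (r t) \<bullet> v)) (at (r t) within S)"
      using grad S[OF t(1)] i y by (simp add: gradient_on_def r_def)
    show "r ` T \<subseteq> S"
      using S i y by (auto simp: r_def)
  qed
  ultimately have "((\<lambda>s. e (r s)) has_derivative (\<lambda>h. \<xi> (r t) \<bullet> (h *\<^sub>R r'))) (at t within T)"
    by (rule has_derivative_in_compose)
  then show "((\<lambda>s. e (on_cells x (\<rho> s) i (gl_point (x (i - 1)) (x i) z))) has_real_derivative
      on_cells x (\<lambda>y. vector_derivative (\<lambda>s. \<rho> s y) (at t within T)) i (gl_point (x (i - 1)) (x i) z)
      \<bullet> xi_h x \<xi> (\<rho> t) i (gl_point (x (i - 1)) (x i) z)) (at t within T)"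
    unfolding y_def[symmetric] r'_def[symmetric] xi_h_def r_def[symmetric]
    by (simp add: has_field_derivative_def mult_commute_abs inner_commute)
qed

text \<open>Positive weights carry the semidefiniteness of \<open>F\<close> at the nodes over to the
  quadrature.\<close>

lemma dissipation_nonneg:
  assumes "k \<ge> 1" and mesh: "\<forall>i\<in>{1..N}. x (i - 1) < x i"
    and "\<forall>i\<in>{1..N}. \<forall>y\<in>{x (i - 1)..x i}. on_cells x \<rho> i y \<in> S"
    and "\<forall>r\<in>S. \<forall>z. z \<bullet> (F r *v z) \<ge> 0"
  shows "dissipation N x k F \<rho> u \<ge> 0"
  unfolding dissipation_def domain_quad_def cell_quad_def matvec_h_def
  using assms by (intro sum_nonneg gl_quad_nonneg) (auto intro: less_imp_le)

lemma traces_in: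
  assumes mesh: "\<forall>i\<in>{1..N}. x (i - 1) < x i"
    and w: "\<forall>i\<in>{1..N}. \<forall>y\<in>{x (i - 1)..x i}. w i y \<in> S"
    and i: "i \<in> {1..N}"
  shows "trace_plus N x w i \<in> S" "trace_minus N x w i \<in> S"
proof -
  \<comment> \<open>By periodicity the right trace at interface \<open>N\<close> is taken in cell 1,
    otherwise in cell \<open>i + 1\<close>.\<close>
  have "x 0 \<le> x 1"
    using mesh[rule_format, of 1] i by simp
  moreover have "x i \<le> x (i + 1)" if "i \<noteq> N"
    using mesh[rule_format, of "i + 1"] i that by simp
  ultimately show "trace_plus N x w i \<in> S"
    using w[rule_format, of 1 "x 0"] w[rule_format, of "i + 1" "x i"] i by (auto simp: trace_plus_def)
  show "trace_minus N x w i \<in> S"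
    using w[rule_format, of i "x i"] mesh[rule_format, OF i] i by (simp add: trace_minus_def)
qed

text \<open>This lets monotonicity of \<xi> compare the jumps of \<xi> and \<rho>.\<close>

lemma trace_xi_h:
  "trace_plus N x (xi_h x \<xi> \<rho>) i = \<xi> (trace_plus N x (on_cells x \<rho>) i)"
  "trace_minus N x (xi_h x \<xi> \<rho>) i = \<xi> (trace_minus N x (on_cells x \<rho>) i)"
  by (simp_all add: trace_plus_def trace_minus_def xi_h_def)

text \<open>An interval with interior points lies in the closure of its interior. Time derivatives
  are therefore unique, also the one-sided ones at endpoints in \<open>T\<close>.\<close>

lemma interval_limit_point:
  fixes T :: "real set"
  assumes "is_interval T" "interior T \<noteq> {}" "t \<in> T"
  shows "at t within T \<noteq> bot"
proof -
  have "closure (interior T) = closure T"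
    using assms by (intro convex_closure_interior) (simp_all add: is_interval_convex)
  then have "t \<in> closure (interior T)"
    using assms(3) closure_subset by blast
  then have "t islimpt interior T"
    using islimpt_closure_open[OF open_interior refl, of t T] by (simp only: limpt_of_closure)
  then have "t islimpt T"
    using islimpt_subset interior_subset by blast
  then show ?thesis
    by (simp add: trivial_limit_within)
qed

text \<open>Reduces each choice of fluxes to the algebra at a single interface, with outcome
  \<open>J i\<close>.\<close>

lemma semidiscrete_entropy_derivative:
  fixes \<rho> u :: "real \<Rightarrow> real \<Rightarrow> real ^ 'm"
  assumes sol: "semidiscrete_solution T N x k S F \<xi> xihat Fuhat \<rho> u"
    and mesh: "is_mesh a b N x c" and k: "k \<ge> 1" and grad: "gradient_on S e \<xi>"
    and T: "is_interval T" "interior T \<noteq> {}" and t: "t \<in> T"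
    and periodic: "Fuhat (\<rho> t) (u t) 0 = Fuhat (\<rho> t) (u t) N"
      "xihat (\<rho> t) (u t) 0 = xihat (\<rho> t) (u t) N"
    and D: "\<And>i. trace_plus N x (xi_h x \<xi> (\<rho> t)) i \<bullet> trace_plus N x (matvec_h x F (\<rho> t) (u t)) i
              - trace_minus N x (xi_h x \<xi> (\<rho> t)) i \<bullet> trace_minus N x (matvec_h x F (\<rho> t) (u t)) i
              - Fuhat (\<rho> t) (u t) i \<bullet> jump N x (xi_h x \<xi> (\<rho> t)) i
              - xihat (\<rho> t) (u t) i \<bullet> jump N x (matvec_h x F (\<rho> t) (u t)) i = J i"
  shows "((\<lambda>s. discrete_entropy N x k e (\<rho> s)) has_real_derivative
           - dissipation N x k F (\<rho> t) (u t) + (\<Sum>i=1..N. J i)) (at t within T)"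
proof -
  have mesh': "\<forall>i\<in>{1..N}. x (i - 1) < x i"
    using mesh by (simp add: is_mesh_def)
  have s: "S1 N x k F (\<lambda>y. vector_derivative (\<lambda>s. \<rho> s y) (at t within T)) (\<rho> t) (u t)
          (Fuhat (\<rho> t) (u t))" "S2 N x k \<xi> (\<rho> t) (u t) (xihat (\<rho> t) (u t))"
    using sol t unfolding semidiscrete_solution_def by blast+
  note balance = entropy_balance[OF k mesh' s periodic, unfolded D]
  show ?thesis
    unfolding balance[symmetric]
    using sol t unfolding semidiscrete_solution_def
    by (intro discrete_entropy_has_derivative[OF k mesh' grad t interval_limit_point[OF T t], of \<rho>]) blast+
qed

theorem theorem2p1:
  fixes a b c_mesh :: real and N k :: nat and x :: "nat \<Rightarrow> real"
    and S :: "(real ^ 'm) set"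
    and e :: "real ^ 'm \<Rightarrow> real"
    and \<xi> :: "real ^ 'm \<Rightarrow> real ^ 'm"
    and F :: "real ^ 'm \<Rightarrow> real ^ 'm ^ 'm"
    and T :: "real set"
    and \<rho> u :: "real \<Rightarrow> real \<Rightarrow> real ^ 'm"
  assumes mesh: "is_mesh a b N x c_mesh"
    and degree: "k \<ge> 1"
    and S_convex: "convex S"
    and e_convex: "convex_on S e"
    and xi_gradient: "gradient_on S e \<xi>"
    and xi_differentiable: "\<xi> differentiable_on S"
    and F_psd: "\<forall>r\<in>S. \<forall>z. z \<bullet> (F r *v z) \<ge> 0"
    and time_interval: "is_interval T" "interior T \<noteq> {}"
  shows "(\<forall>G. bounded_diag_quotient S F G \<and>
              semidiscrete_solution T N x k S F \<xi> (xihat_central N x \<xi>) (Fuhat_lf N x F G) \<rho> u \<longrightarrow>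
            (\<forall>t\<in>T.
               let D = - dissipation N x k F (\<rho> t) (u t)
                       - 1 / 2 * (\<Sum>i=1..N. lf_alpha N x G (\<rho> t) (u t) i *
                           (jump N x (xi_h x \<xi> (\<rho> t)) i \<bullet> jump N x (on_cells x (\<rho> t)) i))
               in ((\<lambda>s. discrete_entropy N x k e (\<rho> s)) has_real_derivative D) (at t within T) \<and>
                  D \<le> 0))
       \<and> (semidiscrete_solution T N x k S F \<xi> (xihat_minus N x \<xi>) (Fuhat_plus N x F) \<rho> u \<or>
          semidiscrete_solution T N x k S F \<xi> (xihat_plus N x \<xi>) (Fuhat_minus N x F) \<rho> u \<longrightarrow>
            (\<forall>t\<in>T.
               ((\<lambda>s. discrete_entropy N x k e (\<rho> s)) has_real_derivative
                  - dissipation N x k F (\<rho> t) (u t)) (at t within T)))"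
proof (rule conjI; intro allI impI ballI)
  have N: "N \<ge> 1" and mesh': "\<forall>i\<in>{1..N}. x (i - 1) < x i"
    using mesh by (simp_all add: is_mesh_def)
  note periodic = traces_periodic[OF N]
  note derivative = semidiscrete_entropy_derivative[OF _ mesh degree xi_gradient time_interval]
  {
    fix G t
    assume "bounded_diag_quotient S F G \<and>
      semidiscrete_solution T N x k S F \<xi> (xihat_central N x \<xi>) (Fuhat_lf N x F G) \<rho> u"
    then have sol: "semidiscrete_solution T N x k S F \<xi> (xihat_central N x \<xi>) (Fuhat_lf N x F G) \<rho> u"
      by blast
    assume t: "t \<in> T"
    define \<alpha> where "\<alpha> = lf_alpha N x G (\<rho> t) (u t)"
    define J where "J i = jump N x (xi_h x \<xi> (\<rho> t)) i \<bullet> jump N x (on_cells x (\<rho> t)) i" for i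
    \<comment> \<open>The jump of a product is \<open>{X} [M] + {M} [X]\<close>, which the averages
      in the two fluxes cancel; only the penalty part remains.\<close>
    have "((\<lambda>s. discrete_entropy N x k e (\<rho> s)) has_real_derivative
        - dissipation N x k F (\<rho> t) (u t) + (\<Sum>i=1..N. - 1 / 2 * (\<alpha> i * J i))) (at t within T)"
    proof (rule derivative[OF sol t])
      show "Fuhat_lf N x F G (\<rho> t) (u t) 0 = Fuhat_lf N x F G (\<rho> t) (u t) N"
        by (simp add: Fuhat_lf_def average_def jump_def lf_alpha_def periodic)
      show "xihat_central N x \<xi> (\<rho> t) (u t) 0 = xihat_central N x \<xi> (\<rho> t) (u t) N"
        by (simp add: xihat_central_def average_def periodic)
    qed (simp add: Fuhat_lf_def xihat_central_def average_def jump_def \<alpha>_def J_def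
        inner_diff_left inner_diff_right inner_add_left inner_add_right inner_commute field_simps)
    moreover have "- dissipation N x k F (\<rho> t) (u t) + (\<Sum>i=1..N. - 1 / 2 * (\<alpha> i * J i)) =
        - dissipation N x k F (\<rho> t) (u t) - 1 / 2 * (\<Sum>i=1..N. \<alpha> i * J i)"
      by (simp add: sum_distrib_left sum_negf)
    ultimately have deriv: "((\<lambda>s. discrete_entropy N x k e (\<rho> s)) has_real_derivative
        - dissipation N x k F (\<rho> t) (u t) - 1 / 2 * (\<Sum>i=1..N. \<alpha> i * J i)) (at t within T)"
      by (simp only:)
    have S: "\<forall>i\<in>{1..N}. \<forall>y\<in>{x (i - 1)..x i}. on_cells x (\<rho> t) i y \<in> S"
      using sol t unfolding semidiscrete_solution_def by blast
    have "dissipation N x k F (\<rho> t) (u t) \<ge> 0"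
      by (rule dissipation_nonneg[OF degree mesh' S F_psd])
    moreover have "(\<Sum>i=1..N. \<alpha> i * J i) \<ge> 0"
    proof (intro sum_nonneg mult_nonneg_nonneg)
      fix i assume i: "i \<in> {1..N}"
      show "\<alpha> i \<ge> 0"
        by (simp add: \<alpha>_def lf_alpha_def infnorm_pos_le le_max_iff_disj)
      show "J i \<ge> 0"
        unfolding J_def jump_def trace_xi_h
        by (rule gradient_on_monotone[OF e_convex xi_gradient]; rule traces_in[OF mesh' S i])
    qed
    ultimately show "let D = - dissipation N x k F (\<rho> t) (u t)
                       - 1 / 2 * (\<Sum>i=1..N. lf_alpha N x G (\<rho> t) (u t) i *
                           (jump N x (xi_h x \<xi> (\<rho> t)) i \<bullet> jump N x (on_cells x (\<rho> t)) i))
               in ((\<lambda>s. discrete_entropy N x k e (\<rho> s)) has_real_derivative D) (at t within T) \<and>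
                  D \<le> 0"
      unfolding Let_def \<alpha>_def[symmetric] J_def[symmetric] using deriv by simp
  next
    fix t
    assume "semidiscrete_solution T N x k S F \<xi> (xihat_minus N x \<xi>) (Fuhat_plus N x F) \<rho> u \<or>
          semidiscrete_solution T N x k S F \<xi> (xihat_plus N x \<xi>) (Fuhat_minus N x F) \<rho> u"
      and t: "t \<in> T"
    \<comment> \<open>The jump of a product is also \<open>X^- [M] + M^+ [X]\<close>, and likewise
      with the signs exchanged, so each alternating pair cancels it completely.\<close>
    then have "((\<lambda>s. discrete_entropy N x k e (\<rho> s)) has_real_derivative
        - dissipation N x k F (\<rho> t) (u t) + (\<Sum>i=1..N. 0)) (at t within T)"
    proof (elim disjE)
      assume "semidiscrete_solution T N x k S F \<xi> (xihat_minus N x \<xi>) (Fuhat_plus N x F) \<rho> u"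
      from derivative[OF this t] show ?thesis
        by (simp add: xihat_minus_def Fuhat_plus_def periodic jump_def inner_diff_right inner_commute)
    next
      assume "semidiscrete_solution T N x k S F \<xi> (xihat_plus N x \<xi>) (Fuhat_minus N x F) \<rho> u"
      from derivative[OF this t] show ?thesis
        by (simp add: xihat_plus_def Fuhat_minus_def periodic jump_def inner_diff_right inner_commute)
    qed
    then show "((\<lambda>s. discrete_entropy N x k e (\<rho> s)) has_real_derivative
        - dissipation N x k F (\<rho> t) (u t)) (at t within T)"
      by simp
  }
qed

end
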